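(* Let $\Pi$ be a finite and satisfiable set of constraints over the variables $x_1,\dots,x_D$. For any sample $\tilde{x}\in\mathbb{R}^D$ and any variable ordering, the corresponding sample $\mathrm{DRL}(\tilde{x})$ is optimal with respect to $\tilde x$, $\Pi$ and the variable ordering; that is, with the variables named so that the ordering is $x_1;x_2;\dots;x_D$, for each $i=1,\dots,D$ there does not exist a sample $x'\in\Omega(\Pi)$ such that $|\tilde x_i-x'_i|<|\tilde x_i-\mathrm{DRL}(\tilde x)_i|$ and, for all $j<i$, $x'_j=\mathrm{DRL}(\tilde x)_j$.
   Context: Constraints. Fix variables $x_1,\dots,x_D$ ranging over $\mathbb{R}$. A linear inequality is an expression $\sum_k w_k x_k + b\ge 0$ with $w_k,b\in\mathbb{R}$; $x_i$ occurs positively in it if $w_i>0$, negatively if $w_i<0$, and does not occur in it if $w_i=0$. When writing an inequality as $w_ix_i+\varphi\ge 0$ it is understood that $w_i\ne 0$ and that $\varphi=\sum_{k\neq i}w_kx_k+b$ does not contain $x_i$. A constraint $\Psi$ is a finite disjunction of linear inequalities (also viewed as the finite set of its disjuncts). A sample is a vector $\tilde x\in\mathbb{R}^D$ (assigning $\tilde x_k$ to $x_k$). A sample satisfies a constraint if it satisfies at least one of its linear inequalities, and satisfies a set $\Pi$ of constraints if it satisfies every constraint in $\Pi$. $\Omega(\Pi)$ is the set of points satisfying $\Pi$; $\Pi$ is satisfiable if $\Omega(\Pi)\neq\emptyset$. Variable ordering. A variable ordering is a total ordering of the variables; after renaming the variables, assume it is $x_1;x_2;\dots;x_D$. All the following definitions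 are relative to this ordering. CP resolution. Let $\Psi=\bigvee_{k=1}^n(w_kx_i+\varphi_k\ge0)\vee\Phi$ and $\Psi'=\bigvee_{j=1}^m(w'_jx_i+\varphi'_j\ge0)\vee\Phi'$ with $m,n\ge1$, $w'_1,\dots,w'_m<0<w_1,\dots,w_n$, where $\Phi$ contains no positive occurrence of $x_i$ and $\Phi'$ contains no negative occurrence of $x_i$ ($\Phi,\Phi'$ are possibly empty disjunctions of linear inequalities). Then $$\mathrm{CPres}_i(\Psi,\Psi')=\bigvee_{j=1}^m\bigvee_{k=1}^n\left(\frac{\varphi_k}{w_k}-\frac{\varphi'_j}{w'_j}\ge0\right)\vee\Phi\vee\Phi'.$$ Variable elimination. Set $\Pi_D=\Pi$. For $i=D,\dots,1$, given $\Pi_i$, let $\Pi_i^+$ be the set of constraints in $\Pi_i$ with positive and without negative occurrences of $x_i$; $\Pi_i^-$ the set of those with negative and without positive occurrences of $x_i$; $\Pi_i^{\pm}$ the set of those with both positive and negative occurrences of $x_i$. Let $\Pi_i^0=\Pi_i^+$, $\Pi_i^{k+1}=\{\mathrm{CPres}_i(\Psi,\Psi')\mid\Psi\in\Pi_i^k,\ \Psi'\in\Pi_i^\pm\}$, and $\Pi_i^{++}=\bigcup_{k=0}^{|\Pi_i^\pm|}\Pi_i^k$. Define $$\Pi_{i-1}=\bigl(\Pi_i\setminus(\Pi_i^+\cup\Pi_i^-\cup\Pi_i^\pm)\bigr)\cup\{\mathrm{CPres}_i(\Psi,\Psi')\mid\Psi\in\Pi_i^{++},\ \Psi'\in\Pi_i^-\}.$$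 Boundaries. For a constraint $\Psi$ in the single variable $x_i$, let $$l_i^\Psi=\max_{(w_ix_i+\varphi\ge0)\in\Psi:\,w_i<0}\left(-\frac{\varphi}{w_i}\right),\qquad r_i^\Psi=\min_{(w_ix_i+\varphi\ge0)\in\Psi:\,w_i>0}\left(-\frac{\varphi}{w_i}\right),$$ with the conventions $\max\emptyset=-\infty$, $\min\emptyset=+\infty$. Definition of $\mathrm{DRL}(\tilde x)$. The components $\mathrm{DRL}(\tilde x)_1,\dots,\mathrm{DRL}(\tilde x)_D$ are computed successively for $i=1,\dots,D$. Let $\widetilde\Pi_i$ be the set of constraints in the variable $x_i$ obtained from $\Pi_i$ by substituting $x_1,\dots,x_{i-1}$ with $\mathrm{DRL}(\tilde x)_1,\dots,\mathrm{DRL}(\tilde x)_{i-1}$. For a real value $v$, write $v\in\Omega(\widetilde\Pi_i)$ if assigning $v$ to $x_i$ satisfies $\widetilde\Pi_i$ ($\pm\infty$ never belong to $\Omega(\widetilde\Pi_i)$). Let $$l_i=\max\{l_i^\Psi:\Psi\in\widetilde\Pi_i,\ \tilde x_i>l_i^\Psi,\ l_i^\Psi\in\Omega(\widetilde\Pi_i)\},\qquad r_i=\min\{r_i^\Psi:\Psi\in\widetilde\Pi_i,\ \tilde x_i<r_i^\Psi,\ r_i^\Psi\in\Omega(\widetilde\Pi_i)\}.$$ Then $\mathrm{DRL}(\tilde x)_i=\tilde x_i$ if $\tilde x_i\in\Omega(\widetilde\Pi_i)$; $\mathrm{DRL}(\tilde x)_i=l_i$ if $\tilde x_i\notin\Omega(\widetilde\Pi_i)$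 and $|\tilde x_i-l_i|<|\tilde x_i-r_i|$; and $\mathrm{DRL}(\tilde x)_i=r_i$ otherwise (with $|\tilde x_i-(\pm\infty)|=+\infty$). *)

theory Defs
  imports "HOL-Analysis.Analysis"
begin

text \<open>
  Variables are the elements of a finite type \<open>'n\<close>, so \<open>D = CARD('n)\<close>. A variable ordering is an
  enumeration \<open>\<sigma> 1, \<dots>, \<sigma> D\<close> of the variables, and every \<open>x\<^sub>i\<close> of the mathematics becomes \<open>\<sigma> i\<close>.
  The pair \<open>(w, b)\<close> stands for the inequality \<open>(\<Sum>k. w\<^sub>k x\<^sub>k) + b \<ge> 0\<close>, and a constraint is the
  (finite) set of its disjuncts.
\<close>

type_synonym 'n lin_ineq = "(real^'n) \<times> real"
type_synonym 'n clause = "'n lin_ineq set"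

definition variable_ordering :: "(nat \<Rightarrow> 'n::finite) \<Rightarrow> bool" where
  "variable_ordering \<sigma> \<longleftrightarrow> bij_betw \<sigma> {1..CARD('n)} UNIV"

definition sat_ineq :: "real^'n::finite \<Rightarrow> 'n lin_ineq \<Rightarrow> bool" where
  "sat_ineq x l \<longleftrightarrow> (\<Sum>k\<in>UNIV. fst l $ k * x $ k) + snd l \<ge> 0"

definition sat_clause :: "real^'n::finite \<Rightarrow> 'n clause \<Rightarrow> bool" where
  "sat_clause x \<Psi> \<longleftrightarrow> (\<exists>l\<in>\<Psi>. sat_ineq x l)"

definition Omega :: "'n::finite clause set \<Rightarrow> (real^'n) set" where
  "Omega P = {x. \<forall>\<Psi>\<in>P. sat_clause x \<Psi>}"

definition satisfiable :: "'n::finite clause set \<Rightarrow> bool" where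
  "satisfiable P \<longleftrightarrow> Omega P \<noteq> {}"


definition pos_ineqs :: "'n::finite \<Rightarrow> 'n clause \<Rightarrow> 'n clause" where
  "pos_ineqs v \<Psi> = {l\<in>\<Psi>. fst l $ v > 0}"

definition neg_ineqs :: "'n::finite \<Rightarrow> 'n clause \<Rightarrow> 'n clause" where
  "neg_ineqs v \<Psi> = {l\<in>\<Psi>. fst l $ v < 0}"

text \<open>
  For \<open>l\<close> the inequality \<open>w v + \<phi> \<ge> 0\<close> and \<open>l'\<close> the inequality \<open>w' v + \<phi>' \<ge> 0\<close>, this is
  \<open>\<phi> / w - \<phi>' / w' \<ge> 0\<close>; as \<open>\<phi>\<close> and \<open>\<phi>'\<close> do not contain \<open>v\<close>, the coefficient at \<open>v\<close> is \<open>0\<close>.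
\<close>
definition resolve_ineq :: "'n::finite \<Rightarrow> 'n lin_ineq \<Rightarrow> 'n lin_ineq \<Rightarrow> 'n lin_ineq" where
  "resolve_ineq v l l' =
     ((\<chi> k. if k = v then 0 else fst l $ k / fst l $ v - fst l' $ k / fst l' $ v),
      snd l / fst l $ v - snd l' / fst l' $ v)"

text \<open>
  Only meaningful if \<open>v\<close> occurs positively in \<open>\<Psi>\<close> and negatively in \<open>\<Psi>'\<close>. The side disjunctions
  \<open>\<Phi>\<close> and \<open>\<Phi>'\<close> are determined by \<open>\<Psi>\<close> and \<open>\<Psi>'\<close>, since \<open>\<Phi>\<close> must have no positive and \<open>\<Phi>'\<close> no
  negative occurrence of \<open>v\<close>.
\<close>
definition CPres :: "'n::finite \<Rightarrow> 'n clause \<Rightarrow> 'n clause \<Rightarrow> 'n clause" where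
  "CPres v \<Psi> \<Psi>' =
     {resolve_ineq v l l' | l l'. l \<in> pos_ineqs v \<Psi> \<and> l' \<in> neg_ineqs v \<Psi>'}
     \<union> (\<Psi> - pos_ineqs v \<Psi>) \<union> (\<Psi>' - neg_ineqs v \<Psi>')"


definition only_pos :: "'n::finite \<Rightarrow> 'n clause set \<Rightarrow> 'n clause set" where
  "only_pos v P = {\<Psi>\<in>P. pos_ineqs v \<Psi> \<noteq> {} \<and> neg_ineqs v \<Psi> = {}}"

definition only_neg :: "'n::finite \<Rightarrow> 'n clause set \<Rightarrow> 'n clause set" where
  "only_neg v P = {\<Psi>\<in>P. neg_ineqs v \<Psi> \<noteq> {} \<and> pos_ineqs v \<Psi> = {}}"

definition pos_neg :: "'n::finite \<Rightarrow> 'n clause set \<Rightarrow> 'n clause set" where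
  "pos_neg v P = {\<Psi>\<in>P. pos_ineqs v \<Psi> \<noteq> {} \<and> neg_ineqs v \<Psi> \<noteq> {}}"

primrec pos_iter :: "'n::finite \<Rightarrow> 'n clause set \<Rightarrow> nat \<Rightarrow> 'n clause set" where
  "pos_iter v P 0 = only_pos v P"
| "pos_iter v P (Suc k) = {CPres v \<Psi> \<Psi>' | \<Psi> \<Psi>'. \<Psi> \<in> pos_iter v P k \<and> \<Psi>' \<in> pos_neg v P}"

definition pos_closure :: "'n::finite \<Rightarrow> 'n clause set \<Rightarrow> 'n clause set" where
  "pos_closure v P = (\<Union>k\<in>{0..card (pos_neg v P)}. pos_iter v P k)"

definition eliminate :: "'n::finite \<Rightarrow> 'n clause set \<Rightarrow> 'n clause set" where
  "eliminate v P =
     (P - (only_pos v P \<union> only_neg v P \<union> pos_neg v P))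
     \<union> {CPres v \<Psi> \<Psi>' | \<Psi> \<Psi>'. \<Psi> \<in> pos_closure v P \<and> \<Psi>' \<in> only_neg v P}"

text \<open>\<open>elim_last \<sigma> P k\<close> is \<open>P\<close> after eliminating the last \<open>k\<close> variables, i.e. \<open>\<Pi>\<^bsub>D-k\<^esub>\<close>.\<close>
primrec elim_last :: "(nat \<Rightarrow> 'n::finite) \<Rightarrow> 'n clause set \<Rightarrow> nat \<Rightarrow> 'n clause set" where
  "elim_last \<sigma> P 0 = P"
| "elim_last \<sigma> P (Suc k) = eliminate (\<sigma> (CARD('n) - k)) (elim_last \<sigma> P k)"

definition stage :: "(nat \<Rightarrow> 'n::finite) \<Rightarrow> 'n clause set \<Rightarrow> nat \<Rightarrow> 'n clause set" where
  "stage \<sigma> P i = elim_last \<sigma> P (CARD('n) - i)"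


text \<open>
  In the next three definitions the constraints contain no variable other than \<open>v\<close>. Hence the
  \<open>\<phi>\<close> of \<open>w v + \<phi> \<ge> 0\<close> is just the constant term, and the value that \<open>axis v c\<close> gives to the other
  variables is irrelevant.
\<close>
definition lower_bd :: "'n::finite \<Rightarrow> 'n clause \<Rightarrow> ereal" where
  "lower_bd v \<Psi> = Max (insert (-\<infinity>) {ereal (- (snd l / fst l $ v)) | l. l \<in> neg_ineqs v \<Psi>})"

definition upper_bd :: "'n::finite \<Rightarrow> 'n clause \<Rightarrow> ereal" where
  "upper_bd v \<Psi> = Min (insert \<infinity> {ereal (- (snd l / fst l $ v)) | l. l \<in> pos_ineqs v \<Psi>})"

definition Omega_var :: "'n::finite \<Rightarrow> 'n clause set \<Rightarrow> real set" where
  "Omega_var v P = {c. axis v c \<in> Omega P}"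


definition subst_ineq :: "'n::finite set \<Rightarrow> real^'n \<Rightarrow> 'n lin_ineq \<Rightarrow> 'n lin_ineq" where
  "subst_ineq S y l =
     ((\<chi> k. if k \<in> S then 0 else fst l $ k), snd l + (\<Sum>k\<in>S. fst l $ k * y $ k))"

text \<open>\<open>\<Pi>\<^sub>i\<close> with \<open>x\<^sub>1, \<dots>, x\<^bsub>i-1\<^esub>\<close> replaced by their values under \<open>y\<close>.\<close>
definition stage_subst ::
    "(nat \<Rightarrow> 'n::finite) \<Rightarrow> 'n clause set \<Rightarrow> nat \<Rightarrow> real^'n \<Rightarrow> 'n clause set" where
  "stage_subst \<sigma> P i y = (\<lambda>\<Psi>. subst_ineq (\<sigma> ` {1..<i}) y ` \<Psi>) ` stage \<sigma> P i"

definition nearest_lower :: "'n::finite \<Rightarrow> 'n clause set \<Rightarrow> real \<Rightarrow> ereal" where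
  "nearest_lower v Q c = Max (insert (-\<infinity>)
     {lower_bd v \<Psi> | \<Psi>. \<Psi> \<in> Q \<and> ereal c > lower_bd v \<Psi> \<and> lower_bd v \<Psi> \<in> ereal ` Omega_var v Q})"

definition nearest_upper :: "'n::finite \<Rightarrow> 'n clause set \<Rightarrow> real \<Rightarrow> ereal" where
  "nearest_upper v Q c = Min (insert \<infinity>
     {upper_bd v \<Psi> | \<Psi>. \<Psi> \<in> Q \<and> ereal c < upper_bd v \<Psi> \<and> upper_bd v \<Psi> \<in> ereal ` Omega_var v Q})"

text \<open>
  If both bounds are infinite, which requires \<open>Omega_var v Q\<close> to be empty, the result is the
  arbitrary value \<open>real_of_ereal \<infinity> = 0\<close>.
\<close>
definition repair :: "'n::finite \<Rightarrow> 'n clause set \<Rightarrow> real \<Rightarrow> real" where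
  "repair v Q c =
     (let l = nearest_lower v Q c; r = nearest_upper v Q c in
      if c \<in> Omega_var v Q then c
      else if \<bar>ereal c - l\<bar> < \<bar>ereal c - r\<bar> then real_of_ereal l
      else real_of_ereal r)"

text \<open>
  \<open>DRL_upto \<sigma> P x i\<close> has its components \<open>\<sigma> 1, \<dots>, \<sigma> i\<close> final; the remaining ones are still those
  of \<open>x\<close> and are not read by \<open>stage_subst\<close>.
\<close>
primrec DRL_upto :: "(nat \<Rightarrow> 'n::finite) \<Rightarrow> 'n clause set \<Rightarrow> real^'n \<Rightarrow> nat \<Rightarrow> real^'n" where
  "DRL_upto \<sigma> P x 0 = x"
| "DRL_upto \<sigma> P x (Suc i) =
     (\<chi> k. if k = \<sigma> (Suc i)
           then repair k (stage_subst \<sigma> P (Suc i) (DRL_upto \<sigma> P x i)) (x $ k)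
           else DRL_upto \<sigma> P x i $ k)"

definition DRL :: "(nat \<Rightarrow> 'n::finite) \<Rightarrow> 'n clause set \<Rightarrow> real^'n \<Rightarrow> real^'n" where
  "DRL \<sigma> P x = DRL_upto \<sigma> P x CARD('n)"

definition optimal ::
    "(nat \<Rightarrow> 'n::finite) \<Rightarrow> 'n clause set \<Rightarrow> real^'n \<Rightarrow> real^'n \<Rightarrow> bool" where
  "optimal \<sigma> P x y \<longleftrightarrow>
     (\<forall>i\<in>{1..CARD('n)}. \<not> (\<exists>x'\<in>Omega P.
        \<bar>x $ \<sigma> i - x' $ \<sigma> i\<bar> < \<bar>x $ \<sigma> i - y $ \<sigma> i\<bar> \<and>
        (\<forall>j\<in>{1..<i}. x' $ \<sigma> j = y $ \<sigma> j)))"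

end

theory Submission imports Defs begin

text \<open>
  Resolution is sound, so every solution of \<open>\<Pi>\<close> solves every stage \<open>\<Pi>\<^sub>i\<close>, and \<open>\<Pi>\<^sub>i\<close> contains only
  the first \<open>i\<close> variables. Hence a competing sample \<open>x'\<close> that agrees with \<open>DRL(x)\<close> before \<open>i\<close>
  yields a point of the one-variable solution set at step \<open>i\<close>. A clause in one variable fails exactly
  on an open interval (or nowhere), so from a point \<open>c\<close> outside the solution set one
  reaches a solution at least as close as \<open>x'\<^sub>i\<close> by moving from endpoint to endpoint of failing
  clauses; such endpoints are the candidates that \<open>DRL\<close> minimises over. Completeness of the
  elimination is not needed.
\<close>

section \<open>Soundness of elimination\<close>

definition ineq_val :: "real^'n::finite \<Rightarrow> 'n lin_ineq \<Rightarrow> real" where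
  "ineq_val x l = (\<Sum>k\<in>UNIV. fst l $ k * x $ k) + snd l"

lemma sat_ineq_iff_ineq_val: "sat_ineq x l \<longleftrightarrow> ineq_val x l \<ge> 0"
  by (simp add: sat_ineq_def ineq_val_def)

text \<open>After division by its coefficient at \<open>v\<close>, each inequality contributes
  exactly \<open>x $ v\<close>. These terms cancel in the difference, in agreement with the
  coefficient 0 that \<open>resolve_ineq\<close> puts there.\<close>

lemma ineq_val_resolve_ineq:
  assumes "fst l $ v \<noteq> 0" "fst l' $ v \<noteq> 0"
  shows "ineq_val x (resolve_ineq v l l') = ineq_val x l / fst l $ v - ineq_val x l' / fst l' $ v"
proof -
  have "fst (resolve_ineq v l l') $ k * x $ k =
      fst l $ k * x $ k / fst l $ v - fst l' $ k * x $ k / fst l' $ v" for k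
    using assms by (simp add: resolve_ineq_def left_diff_distrib)
  then show ?thesis
    unfolding ineq_val_def
    by (simp add: sum_subtractf sum_divide_distrib add_divide_distrib)
       (simp add: resolve_ineq_def)
qed

text \<open>Take a satisfied disjunct of each parent. If both are resolved upon, the opposite signs
  of their coefficients make the difference nonnegative; otherwise one of them survives in the
  resolvent.\<close>

lemma sat_clause_CPres:
  assumes "sat_clause x \<Psi>" "sat_clause x \<Psi>'"
  shows "sat_clause x (CPres v \<Psi> \<Psi>')"
proof -
  obtain l l' where l: "l \<in> \<Psi>" "sat_ineq x l" and l': "l' \<in> \<Psi>'" "sat_ineq x l'"
    using assms by (auto simp: sat_clause_def)
  show ?thesis
  proof (cases "l \<in> pos_ineqs v \<Psi> \<and> l' \<in> neg_ineqs v \<Psi>'")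
    case True
    then have w: "fst l $ v > 0" "fst l' $ v < 0"
      by (auto simp: pos_ineqs_def neg_ineqs_def)
    have "0 \<le> ineq_val x l / fst l $ v" "ineq_val x l' / fst l' $ v \<le> 0"
      using w l(2) l'(2) by (auto simp: sat_ineq_iff_ineq_val divide_nonneg_neg)
    with w have "sat_ineq x (resolve_ineq v l l')"
      by (simp add: sat_ineq_iff_ineq_val ineq_val_resolve_ineq)
    moreover have "resolve_ineq v l l' \<in> CPres v \<Psi> \<Psi>'"
      using True unfolding CPres_def by blast
    ultimately show ?thesis by (auto simp: sat_clause_def)
  next
    case False
    then have "l \<in> CPres v \<Psi> \<Psi>' \<or> l' \<in> CPres v \<Psi> \<Psi>'"
      using l(1) l'(1) by (auto simp: CPres_def)
    then show ?thesis using l(2) l'(2) by (auto simp: sat_clause_def)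
  qed
qed

lemma Omega_pos_iter:
  assumes "x \<in> Omega P"
  shows "x \<in> Omega (pos_iter v P k)"
proof (induction k)
  case 0
  show ?case using assms by (auto simp: Omega_def only_pos_def)
next
  case (Suc k)
  then show ?case using assms by (auto simp: Omega_def pos_neg_def intro!: sat_clause_CPres)
qed

lemma Omega_eliminate:
  assumes "x \<in> Omega P"
  shows "x \<in> Omega (eliminate v P)"
  using assms Omega_pos_iter[OF assms, of v]
  by (auto simp: Omega_def eliminate_def pos_closure_def only_neg_def intro!: sat_clause_CPres)

lemma Omega_elim_last: "x \<in> Omega P \<Longrightarrow> x \<in> Omega (elim_last \<sigma> P k)"
  by (induction k) (auto intro: Omega_eliminate)

section \<open>Finiteness and occurring variables\<close>

lemma finite_CPres:
  assumes "finite \<Psi>" "finite \<Psi>'"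
  shows "finite (CPres v \<Psi> \<Psi>')"
proof -
  have "finite (pos_ineqs v \<Psi>)" "finite (neg_ineqs v \<Psi>')"
    using assms by (auto simp: pos_ineqs_def neg_ineqs_def)
  then show ?thesis
    using assms unfolding CPres_def by (intro finite_UnI finite_image_set2 finite_Diff) auto
qed

text \<open>\<open>Max\<close> and \<open>Min\<close> in the boundaries and in \<open>repair\<close>
  are meaningful on finite sets only, so finiteness of the set and of each clause is carried through
  the elimination.\<close>

definition fin_clauses :: "'n::finite clause set \<Rightarrow> bool" where
  "fin_clauses P \<longleftrightarrow> finite P \<and> (\<forall>\<Psi>\<in>P. finite \<Psi>)"

lemma fin_clauses_CPres:
  assumes "fin_clauses A" "fin_clauses B"
  shows "fin_clauses {CPres v \<Psi> \<Psi>' | \<Psi> \<Psi>'. \<Psi> \<in> A \<and> \<Psi>' \<in> B}"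
  using assms by (auto simp: fin_clauses_def intro: finite_image_set2 finite_CPres)

lemma fin_clauses_subset: "fin_clauses P \<Longrightarrow> Q \<subseteq> P \<Longrightarrow> fin_clauses Q"
  by (auto simp: fin_clauses_def intro: finite_subset)

lemma fin_clauses_pos_iter: "fin_clauses P \<Longrightarrow> fin_clauses (pos_iter v P k)"
proof (induction k)
  case 0
  then show ?case by (auto simp: only_pos_def intro: fin_clauses_subset)
next
  case (Suc k)
  then have "fin_clauses (pos_neg v P)" by (auto simp: pos_neg_def intro: fin_clauses_subset)
  with Suc show ?case by (simp add: fin_clauses_CPres)
qed

lemma fin_clauses_eliminate:
  assumes "fin_clauses P"
  shows "fin_clauses (eliminate v P)"
proof -
  have "fin_clauses (pos_closure v P)"
    using fin_clauses_pos_iter[OF assms] by (auto simp: pos_closure_def fin_clauses_def)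
  moreover have "fin_clauses (only_neg v P)"
    using assms by (auto simp: only_neg_def intro: fin_clauses_subset)
  ultimately have "fin_clauses {CPres v \<Psi> \<Psi>' | \<Psi> \<Psi>'. \<Psi> \<in> pos_closure v P \<and> \<Psi>' \<in> only_neg v P}"
    by (rule fin_clauses_CPres)
  then show ?thesis
    using assms unfolding eliminate_def fin_clauses_def by blast
qed

lemma fin_clauses_elim_last: "fin_clauses P \<Longrightarrow> fin_clauses (elim_last \<sigma> P k)"
  by (induction k) (auto intro: fin_clauses_eliminate)

section \<open>Variables that occur after elimination\<close>

definition not_occurs :: "'n::finite \<Rightarrow> 'n clause set \<Rightarrow> bool" where
  "not_occurs u P \<longleftrightarrow> (\<forall>\<Psi>\<in>P. \<forall>l\<in>\<Psi>. fst l $ u = 0)"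

lemma resolve_ineq_coeff_eq_0:
  assumes "u = v \<or> fst l $ u = 0 \<and> fst l' $ u = 0"
  shows "fst (resolve_ineq v l l') $ u = 0"
  using assms by (auto simp: resolve_ineq_def)

lemma not_occurs_CPres:
  assumes "not_occurs u A" "not_occurs u B"
  shows "not_occurs u {CPres v \<Psi> \<Psi>' | \<Psi> \<Psi>'. \<Psi> \<in> A \<and> \<Psi>' \<in> B}"
  using assms
  by (fastforce simp: not_occurs_def CPres_def pos_ineqs_def neg_ineqs_def
      intro: resolve_ineq_coeff_eq_0)

lemma not_occurs_pos_iter: "not_occurs u P \<Longrightarrow> not_occurs u (pos_iter v P k)"
proof (induction k)
  case 0
  then show ?case by (auto simp: only_pos_def not_occurs_def)
next
  case (Suc k)
  then have "not_occurs u (pos_neg v P)" by (auto simp: pos_neg_def not_occurs_def)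
  with Suc show ?case by (simp add: not_occurs_CPres)
qed

lemma not_occurs_eliminate:
  assumes "not_occurs u P"
  shows "not_occurs u (eliminate v P)"
proof -
  have "not_occurs u (pos_closure v P)"
    using not_occurs_pos_iter[OF assms] by (auto simp: pos_closure_def not_occurs_def)
  moreover have "not_occurs u (only_neg v P)"
    using assms by (auto simp: only_neg_def not_occurs_def)
  ultimately have "not_occurs u {CPres v \<Psi> \<Psi>' | \<Psi> \<Psi>'. \<Psi> \<in> pos_closure v P \<and> \<Psi>' \<in> only_neg v P}"
    by (rule not_occurs_CPres)
  then show ?thesis
    using assms unfolding eliminate_def not_occurs_def by blast
qed

text \<open>The resolved inequalities lose \<open>v\<close> altogether, the rest of the first parent
  has lost its positive occurrences of \<open>v\<close>, and the rest of the second its negative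
  ones.\<close>

lemma CPres_coeff_cases:
  assumes "l \<in> CPres v \<Psi> \<Psi>'"
  obtains "fst l $ v = 0" | "l \<in> \<Psi>" "fst l $ v \<le> 0" | "l \<in> \<Psi>'" "fst l $ v \<ge> 0"
  using assms
  by (auto simp: CPres_def pos_ineqs_def neg_ineqs_def not_less resolve_ineq_coeff_eq_0)

text \<open>Resolving against a mixed clause consumes all its negative occurrences of
  \<open>v\<close>, and by induction the first parent has none to pass on.\<close>

lemma pos_iter_coeff_nonneg:
  "\<Psi> \<in> pos_iter v P k \<Longrightarrow> l \<in> \<Psi> \<Longrightarrow> fst l $ v \<ge> 0"
proof (induction k arbitrary: \<Psi> l)
  case 0
  then have "l \<notin> neg_ineqs v \<Psi>" by (simp add: only_pos_def)
  with 0 show ?case by (simp add: neg_ineqs_def not_less)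
next
  case (Suc k)
  then obtain \<Psi>\<^sub>1 \<Psi>\<^sub>2 where "l \<in> CPres v \<Psi>\<^sub>1 \<Psi>\<^sub>2" "\<Psi>\<^sub>1 \<in> pos_iter v P k"
    by auto
  with Suc.IH show ?case
    by (elim CPres_coeff_cases) auto
qed

text \<open>What a resolvent keeps of the first parent has coefficients at \<open>v\<close> that are
  nonnegative by \<open>pos_iter_coeff_nonneg\<close> and nonpositive because the positive ones were
  removed; the second parent is dual. A clause kept unchanged contains \<open>v\<close> with neither
  sign.\<close>

lemma not_occurs_eliminated: "not_occurs v (eliminate v P)"
  unfolding not_occurs_def
proof (intro ballI)
  fix \<Psi> l assume \<Psi>: "\<Psi> \<in> eliminate v P" and l: "l \<in> \<Psi>"
  show "fst l $ v = 0"
  proof (cases "\<exists>\<Psi>\<^sub>1 \<Psi>\<^sub>2. \<Psi> = CPres v \<Psi>\<^sub>1 \<Psi>\<^sub>2 \<and> \<Psi>\<^sub>1 \<in> pos_closure v P \<and> \<Psi>\<^sub>2 \<in> only_neg v P")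
    case True
    then obtain \<Psi>\<^sub>1 \<Psi>\<^sub>2 where eq: "\<Psi> = CPres v \<Psi>\<^sub>1 \<Psi>\<^sub>2"
      and 1: "\<Psi>\<^sub>1 \<in> pos_closure v P" and 2: "\<Psi>\<^sub>2 \<in> only_neg v P"
      by blast
    have "fst m $ v \<ge> 0" if "m \<in> \<Psi>\<^sub>1" for m
      using 1 that pos_iter_coeff_nonneg unfolding pos_closure_def by blast
    moreover have "fst m $ v \<le> 0" if "m \<in> \<Psi>\<^sub>2" for m
    proof -
      have "m \<notin> pos_ineqs v \<Psi>\<^sub>2" using 2 by (simp add: only_neg_def)
      with that show ?thesis by (simp add: pos_ineqs_def not_less)
    qed
    ultimately show ?thesis
      using l unfolding eq by (elim CPres_coeff_cases) (simp_all add: order_antisym)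
  next
    case False
    with \<Psi> have "\<Psi> \<in> P - (only_pos v P \<union> only_neg v P \<union> pos_neg v P)"
      by (auto simp: eliminate_def)
    then have "l \<notin> pos_ineqs v \<Psi>" "l \<notin> neg_ineqs v \<Psi>"
      by (auto simp: only_pos_def only_neg_def pos_neg_def)
    with l show ?thesis by (simp add: pos_ineqs_def neg_ineqs_def)
  qed
qed

lemma not_occurs_elim_last:
  fixes \<sigma> :: "nat \<Rightarrow> 'n::finite"
  assumes "CARD('n) - k < j" "j \<le> CARD('n)"
  shows "not_occurs (\<sigma> j) (elim_last \<sigma> P k)"
  using assms
proof (induction k)
  case 0
  then show ?case by simp
next
  case (Suc k)
  show ?case
  proof (cases "j = CARD('n) - k")
    \<comment> \<open>The step from \<open>k\<close> to \<open>Suc k\<close> eliminates exactly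
      \<open>\<sigma> (CARD('n) - k)\<close>. Variables with a larger index are gone already, and
      elimination does not bring them back.\<close>
    case True
    then show ?thesis by (simp add: not_occurs_eliminated)
  next
    case False
    with Suc show ?thesis by (simp add: not_occurs_eliminate)
  qed
qed

lemma not_occurs_stage:
  fixes \<sigma> :: "nat \<Rightarrow> 'n::finite"
  assumes "i < j" "j \<le> CARD('n)"
  shows "not_occurs (\<sigma> j) (stage \<sigma> P i)"
  using assms by (simp add: stage_def not_occurs_elim_last)

section \<open>One-variable constraints\<close>

lemma sat_ineq_axis: "sat_ineq (axis v c) l \<longleftrightarrow> fst l $ v * c + snd l \<ge> 0"
proof -
  have "(\<Sum>k\<in>UNIV. fst l $ k * axis v c $ k) = (\<Sum>k\<in>UNIV. if k = v then fst l $ v * c else 0)"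
    by (intro sum.cong) (auto simp: axis_def)
  then show ?thesis by (simp add: sat_ineq_def)
qed

text \<open>For w < 0, w c + b < 0 means c > -b/w, so \<open>c\<close> exceeds the maximum exactly
  if every such inequality fails. The inserted -\<infinity> is below every real and imposes no
  condition.\<close>

lemma lower_bd_less_iff:
  assumes "finite \<Psi>"
  shows "lower_bd v \<Psi> < ereal c \<longleftrightarrow> (\<forall>l\<in>neg_ineqs v \<Psi>. fst l $ v * c + snd l < 0)"
proof -
  have fin: "finite (neg_ineqs v \<Psi>)" using assms by (simp add: neg_ineqs_def)
  have "fst l $ v * c + snd l < 0 \<longleftrightarrow> - (snd l / fst l $ v) < c" if "l \<in> neg_ineqs v \<Psi>" for l
    using that by (auto simp: neg_ineqs_def field_simps)
  then show ?thesis
    using fin unfolding lower_bd_def setcompr_eq_image by simp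
qed

lemma less_upper_bd_iff:
  assumes "finite \<Psi>"
  shows "ereal c < upper_bd v \<Psi> \<longleftrightarrow> (\<forall>l\<in>pos_ineqs v \<Psi>. fst l $ v * c + snd l < 0)"
proof -
  have fin: "finite (pos_ineqs v \<Psi>)" using assms by (simp add: pos_ineqs_def)
  have "fst l $ v * c + snd l < 0 \<longleftrightarrow> c < - (snd l / fst l $ v)" if "l \<in> pos_ineqs v \<Psi>" for l
    using that by (auto simp: pos_ineqs_def field_simps)
  then show ?thesis
    using fin unfolding upper_bd_def setcompr_eq_image by simp
qed

text \<open>Splitting the disjuncts by the sign of their coefficient at \<open>v\<close>, the
  constant ones fail independently of \<open>c\<close>, while the others confine \<open>c\<close>
  from below and from above.\<close>

lemma not_sat_clause_axis_iff:
  assumes "finite \<Psi>"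
  shows "\<not> sat_clause (axis v c) \<Psi> \<longleftrightarrow>
    (\<forall>l\<in>\<Psi>. fst l $ v = 0 \<longrightarrow> snd l < 0) \<and> lower_bd v \<Psi> < ereal c \<and> ereal c < upper_bd v \<Psi>"
proof -
  have "\<Psi> = {l\<in>\<Psi>. fst l $ v = 0} \<union> neg_ineqs v \<Psi> \<union> pos_ineqs v \<Psi>"
    by (auto simp: neg_ineqs_def pos_ineqs_def)
  then have "\<not> sat_clause (axis v c) \<Psi> \<longleftrightarrow>
      (\<forall>l\<in>{l\<in>\<Psi>. fst l $ v = 0} \<union> neg_ineqs v \<Psi> \<union> pos_ineqs v \<Psi>. fst l $ v * c + snd l < 0)"
    by (simp add: sat_clause_def sat_ineq_axis not_le)
  moreover have "(\<forall>l\<in>{l\<in>\<Psi>. fst l $ v = 0}. fst l $ v * c + snd l < 0) \<longleftrightarrow>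
      (\<forall>l\<in>\<Psi>. fst l $ v = 0 \<longrightarrow> snd l < 0)"
    by fastforce
  ultimately show ?thesis
    by (simp only: lower_bd_less_iff[OF assms] less_upper_bd_iff[OF assms] ball_Un conj_assoc)
qed

section \<open>Endpoints of open intervals and the nearest solution on a line\<close>

text \<open>Among the left endpoints in \<open>[a, c)\<close> the least one cannot lie in any of the open intervals.\<close>

lemma left_endpoint_outside_intervals:
  fixes lo up :: "'a \<Rightarrow> ereal" and a c :: real
  assumes "finite Q"
    and "a < c"
    and out: "\<forall>\<Psi>\<in>Q. \<not> (lo \<Psi> < ereal a \<and> ereal a < up \<Psi>)"
    and ins: "\<exists>\<Psi>\<in>Q. lo \<Psi> < ereal c \<and> ereal c < up \<Psi>"
  obtains s \<Psi> where "\<Psi> \<in> Q" "lo \<Psi> = ereal s" "a \<le> s" "s < c"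
    "\<forall>\<Psi>'\<in>Q. \<not> (lo \<Psi>' < ereal s \<and> ereal s < up \<Psi>')"
proof -
  define A where "A = {\<Psi>\<in>Q. ereal a \<le> lo \<Psi> \<and> lo \<Psi> < ereal c}"
  \<comment> \<open>If \<open>s\<close> is below the right end, so is \<open>a\<close>; since
    \<open>a\<close> is outside the interval, the left end cannot be below \<open>a\<close>.\<close>
  have left: "ereal a \<le> lo \<Psi>" if "\<Psi> \<in> Q" "ereal s < up \<Psi>" "a \<le> s" for \<Psi> s
    using out that by (meson ereal_less_eq(3) leI order_le_less_trans)
  have "finite A" using \<open>finite Q\<close> by (simp add: A_def)
  moreover have "A \<noteq> {}"
    using ins left[of _ c] \<open>a < c\<close> by (auto simp: A_def)
  ultimately obtain \<Psi> where \<Psi>: "\<Psi> \<in> A" and least: "\<And>\<Psi>'. \<Psi>' \<in> A \<Longrightarrow> lo \<Psi> \<le> lo \<Psi>'"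
    using ex_is_arg_min_if_finite[of A lo] by (auto simp: is_arg_min_linorder)
  obtain s where s: "lo \<Psi> = ereal s"
    using \<Psi> by (cases "lo \<Psi>") (auto simp: A_def)
  have as: "a \<le> s" "s < c" using \<Psi> s by (auto simp: A_def)
  have "\<not> (lo \<Psi>' < ereal s \<and> ereal s < up \<Psi>')" if "\<Psi>' \<in> Q" for \<Psi>'
  proof
    \<comment> \<open>By \<open>left\<close>, an interval around \<open>s\<close> starts in [a, s),
      so its left end would be a smaller one within \<open>A\<close>.\<close>
    assume b: "lo \<Psi>' < ereal s \<and> ereal s < up \<Psi>'"
    have "lo \<Psi>' < ereal c"
      using b as by (meson ereal_less_eq(3) less_imp_le order_less_le_trans)
    with b have "\<Psi>' \<in> A"
      using left[OF that] as(1) that by (auto simp: A_def)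
    with least[of \<Psi>'] b s show False by auto
  qed
  with that \<Psi> s as show ?thesis by (auto simp: A_def)
qed

text \<open>The reflection t -> -t exchanges the roles of \<open>lo\<close> and \<open>up\<close>
  and reduces this to the left case.\<close>

lemma right_endpoint_outside_intervals:
  fixes lo up :: "'a \<Rightarrow> ereal" and a c :: real
  assumes "finite Q"
    and "c < a"
    and out: "\<forall>\<Psi>\<in>Q. \<not> (lo \<Psi> < ereal a \<and> ereal a < up \<Psi>)"
    and ins: "\<exists>\<Psi>\<in>Q. lo \<Psi> < ereal c \<and> ereal c < up \<Psi>"
  obtains s \<Psi> where "\<Psi> \<in> Q" "up \<Psi> = ereal s" "s \<le> a" "c < s"
    "\<forall>\<Psi>'\<in>Q. \<not> (lo \<Psi>' < ereal s \<and> ereal s < up \<Psi>')"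
proof -
  have neg: "- up \<Psi> < ereal (- t) \<and> ereal (- t) < - lo \<Psi> \<longleftrightarrow> lo \<Psi> < ereal t \<and> ereal t < up \<Psi>"
    for \<Psi> t
    by (auto simp flip: uminus_ereal.simps(1))
  have out': "\<forall>\<Psi>\<in>Q. \<not> (- up \<Psi> < ereal (- a) \<and> ereal (- a) < - lo \<Psi>)"
    and ins': "\<exists>\<Psi>\<in>Q. - up \<Psi> < ereal (- c) \<and> ereal (- c) < - lo \<Psi>"
    using out ins unfolding neg by simp_all
  obtain s \<Psi> where "\<Psi> \<in> Q" and s: "- up \<Psi> = ereal s" "- a \<le> s" "s < - c"
    and *: "\<forall>\<Psi>'\<in>Q. \<not> (- up \<Psi>' < ereal s \<and> ereal s < - lo \<Psi>')"
    using left_endpoint_outside_intervals[OF \<open>finite Q\<close> _ out' ins'] \<open>c < a\<close>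
    by (metis neg_less_iff_less)
  have "up \<Psi> = ereal (- s)" using s(1) by (cases "up \<Psi>") auto
  moreover have "\<forall>\<Psi>'\<in>Q. \<not> (lo \<Psi>' < ereal (- s) \<and> ereal (- s) < up \<Psi>')"
    using * neg[of _ "- s"] unfolding minus_minus by blast
  ultimately show ?thesis
    using that[of \<Psi> "- s"] \<open>\<Psi> \<in> Q\<close> s by auto
qed

text \<open>No solution lies strictly between the two candidates \<open>l\<close> and
  \<open>r\<close> around \<open>c\<close>, and \<open>repair\<close> takes the nearer one. The
  existence of \<open>a\<close> forces one of them to be finite, so the default value at infinity is
  never chosen.\<close>

lemma repair_nearest:
  fixes Q :: "'n::finite clause set"
  assumes "fin_clauses Q" and a: "a \<in> Omega_var v Q"
  shows "\<bar>c - repair v Q c\<bar> \<le> \<bar>c - a\<bar>"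
proof (cases "c \<in> Omega_var v Q")
  case True
  then show ?thesis by (simp add: repair_def)
next
  case False
  \<comment> \<open>A clause outside \<open>F\<close> has a constant disjunct that holds, so it is
    satisfied everywhere; only clauses in \<open>F\<close> fail on the open interval between their
    bounds.\<close>
  define F where "F = {\<Psi>\<in>Q. \<forall>l\<in>\<Psi>. fst l $ v = 0 \<longrightarrow> snd l < 0}"
  have "finite Q" using assms by (simp add: fin_clauses_def)
  have "finite F" using assms by (simp add: fin_clauses_def F_def)
  have Omega_iff: "t \<in> Omega_var v Q \<longleftrightarrow>
      (\<forall>\<Psi>\<in>F. \<not> (lower_bd v \<Psi> < ereal t \<and> ereal t < upper_bd v \<Psi>))" for t
    using assms(1) not_sat_clause_axis_iff[of _ v t]
    unfolding Omega_var_def Omega_def F_def fin_clauses_def by blast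
  define L where "L = {lower_bd v \<Psi> | \<Psi>. \<Psi> \<in> Q \<and> ereal c > lower_bd v \<Psi> \<and>
      lower_bd v \<Psi> \<in> ereal ` Omega_var v Q}"
  define U where "U = {upper_bd v \<Psi> | \<Psi>. \<Psi> \<in> Q \<and> ereal c < upper_bd v \<Psi> \<and>
      upper_bd v \<Psi> \<in> ereal ` Omega_var v Q}"
  define l r where "l = nearest_lower v Q c" and "r = nearest_upper v Q c"
  have fin: "finite L" "finite U" using \<open>finite Q\<close> by (auto simp: L_def U_def)
  have l: "l = Max (insert (-\<infinity>) L)" and r: "r = Min (insert \<infinity> U)"
    by (simp_all add: l_def r_def nearest_lower_def nearest_upper_def L_def U_def)
  have "l \<in> insert (-\<infinity>) L" unfolding l using fin by (intro Max_in) auto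
  then have lc: "l < ereal c" by (auto simp: L_def)
  have "r \<in> insert \<infinity> U" unfolding r using fin by (intro Min_in) auto
  then have rc: "ereal c < r" by (auto simp: U_def)
  have ins: "\<exists>\<Psi>\<in>F. lower_bd v \<Psi> < ereal c \<and> ereal c < upper_bd v \<Psi>"
    using False Omega_iff by blast
  have out: "\<forall>\<Psi>\<in>F. \<not> (lower_bd v \<Psi> < ereal a \<and> ereal a < upper_bd v \<Psi>)"
    using a Omega_iff by blast
  have "a \<noteq> c" using a False by auto
  \<comment> \<open>The endpoint \<open>s\<close> found between \<open>a\<close> and
    \<open>c\<close> is itself a solution and a bound of a clause in \<open>Q\<close>, hence one of
    the candidates in \<open>L\<close> or \<open>U\<close>.\<close>
  then have near: "ereal a \<le> l \<or> r \<le> ereal a"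
  proof (rule linorder_neqE)
    assume "a < c"
    from \<open>finite F\<close> this out ins obtain s \<Psi>
      where s: "\<Psi> \<in> F" "lower_bd v \<Psi> = ereal s" "a \<le> s" "s < c" "s \<in> Omega_var v Q"
      unfolding Omega_iff by (rule left_endpoint_outside_intervals)
    then have "ereal s \<in> L" by (force simp: L_def F_def)
    then have "ereal s \<le> l" unfolding l using fin by (intro Max_ge) auto
    then show ?thesis using s(3) by (meson ereal_less_eq(3) order_trans)
  next
    assume "c < a"
    from \<open>finite F\<close> this out ins obtain s \<Psi>
      where s: "\<Psi> \<in> F" "upper_bd v \<Psi> = ereal s" "s \<le> a" "c < s" "s \<in> Omega_var v Q"
      unfolding Omega_iff by (rule right_endpoint_outside_intervals)
    then have "ereal s \<in> U" by (force simp: U_def F_def)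
    then have "r \<le> ereal s" unfolding r using fin by (intro Min_le) auto
    then show ?thesis using s(3) by (meson ereal_less_eq(3) order_trans)
  qed
  have "repair v Q c = (if \<bar>ereal c - l\<bar> < \<bar>ereal c - r\<bar> then real_of_ereal l else real_of_ereal r)"
    using False by (simp add: repair_def l_def r_def Let_def)
  \<comment> \<open>Since l < c < r, the absolute values resolve; the cases cover infinite
    \<open>l\<close> or \<open>r\<close>.\<close>
  with near lc rc show ?thesis
    by (cases l; cases r) (auto split: if_splits)
qed

section \<open>Optimality\<close>

text \<open>Substitution moves the terms over \<open>S\<close> into the constant, and all
  coefficients outside \<open>insert v S\<close> vanish, so only the term at \<open>v\<close>
  remains to be evaluated.\<close>

lemma sat_ineq_axis_subst_ineq:
  assumes "v \<notin> S" and "\<And>k. k \<in> S \<Longrightarrow> z $ k = y $ k"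
    and "\<And>k. k \<notin> S \<Longrightarrow> k \<noteq> v \<Longrightarrow> fst l $ k = 0"
  shows "sat_ineq (axis v (z $ v)) (subst_ineq S y l) \<longleftrightarrow> sat_ineq z l"
proof -
  have "(\<Sum>k\<in>UNIV. fst l $ k * z $ k) = (\<Sum>k\<in>insert v S. fst l $ k * z $ k)"
    using assms(3) by (intro sum.mono_neutral_right) auto
  also have "\<dots> = fst l $ v * z $ v + (\<Sum>k\<in>S. fst l $ k * z $ k)"
    using assms(1) by simp
  also have "(\<Sum>k\<in>S. fst l $ k * z $ k) = (\<Sum>k\<in>S. fst l $ k * y $ k)"
    using assms(2) by (intro sum.cong) auto
  finally show ?thesis
    using assms(1) unfolding sat_ineq_axis by (simp add: sat_ineq_def subst_ineq_def algebra_simps)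
qed

text \<open>Each later step overwrites only its own coordinate \<open>\<sigma> (Suc m)\<close>,
  which differs from \<open>\<sigma> j\<close> by injectivity of the ordering.\<close>

lemma DRL_upto_stable:
  assumes "variable_ordering \<sigma>" "j \<in> {1..i}" "i \<le> m" "m \<le> CARD('n)"
  shows "DRL_upto \<sigma> P x m $ \<sigma> j = DRL_upto \<sigma> P x i $ (\<sigma> j :: 'n::finite)"
  using assms(3,4)
proof (induction m rule: dec_induct)
  case base
  show ?case by simp
next
  case (step m)
  have "inj_on \<sigma> {1..CARD('n)}"
    using assms(1) by (auto simp: variable_ordering_def bij_betw_def)
  then have "\<sigma> j \<noteq> \<sigma> (Suc m)"
    using assms(2) step by (auto dest!: inj_onD)
  with step show ?case by simp
qed

text \<open>By soundness \<open>z\<close> satisfies some disjunct of each clause of the stage. That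
  disjunct contains only the first \<open>i\<close> variables, so substituting values on which
  \<open>z\<close> and \<open>y\<close> agree preserves its truth.\<close>

lemma stage_subst_solution:
  fixes \<sigma> :: "nat \<Rightarrow> 'n::finite"
  assumes ord: "variable_ordering \<sigma>" and i: "i \<in> {1..CARD('n)}"
    and z: "z \<in> Omega P" and eq: "\<And>j. j \<in> {1..<i} \<Longrightarrow> z $ \<sigma> j = y $ \<sigma> j"
  shows "z $ \<sigma> i \<in> Omega_var (\<sigma> i) (stage_subst \<sigma> P i y)"
proof -
  have inj: "inj_on \<sigma> {1..CARD('n)}" and surj: "\<sigma> ` {1..CARD('n)} = UNIV"
    using ord by (auto simp: variable_ordering_def bij_betw_def)
  have notin: "\<sigma> i \<notin> \<sigma> ` {1..<i}"
    using inj i by (auto dest!: inj_onD)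
  have "sat_clause (axis (\<sigma> i) (z $ \<sigma> i)) (subst_ineq (\<sigma> ` {1..<i}) y ` \<Psi>)"
    if \<Psi>: "\<Psi> \<in> stage \<sigma> P i" for \<Psi>
  proof -
    have "z \<in> Omega (stage \<sigma> P i)"
      using z by (simp add: stage_def Omega_elim_last)
    then obtain l where l: "l \<in> \<Psi>" "sat_ineq z l"
      using \<Psi> by (auto simp: Omega_def sat_clause_def)
    \<comment> \<open>Every other variable has an index above \<open>i\<close> and was eliminated
      before this stage.\<close>
    have "fst l $ k = 0" if k: "k \<notin> \<sigma> ` {1..<i}" "k \<noteq> \<sigma> i" for k
    proof -
      obtain j where j: "k = \<sigma> j" "1 \<le> j" "j \<le> CARD('n)"
        using surj by (metis UNIV_I atLeastAtMost_iff imageE)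
      have "j \<noteq> i" "\<not> j < i" using k j by auto
      then have "not_occurs (\<sigma> j) (stage \<sigma> P i)"
        using j by (intro not_occurs_stage) auto
      then show ?thesis using \<Psi> l(1) j(1) by (auto simp: not_occurs_def)
    qed
    moreover have "z $ k = y $ k" if "k \<in> \<sigma> ` {1..<i}" for k
      using that eq by auto
    ultimately have "sat_ineq (axis (\<sigma> i) (z $ \<sigma> i)) (subst_ineq (\<sigma> ` {1..<i}) y l)"
      using sat_ineq_axis_subst_ineq[OF notin, of z y l] l(2) by blast
    then show ?thesis using l(1) by (auto simp: sat_clause_def)
  qed
  then show ?thesis by (auto simp: Omega_var_def Omega_def stage_subst_def)
qed

theorem theorem3p6:
  fixes P :: "'n::finite clause set" and x :: "real^'n" and \<sigma> :: "nat \<Rightarrow> 'n"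
  assumes "finite P" and "\<And>\<Psi>. \<Psi> \<in> P \<Longrightarrow> finite \<Psi>"
    and "satisfiable P"
    and "variable_ordering \<sigma>"
  shows "optimal \<sigma> P x (DRL \<sigma> P x)"
  unfolding optimal_def
proof (intro ballI notI)
  fix i assume i: "i \<in> {1..CARD('n)}"
  assume "\<exists>x'\<in>Omega P. \<bar>x $ \<sigma> i - x' $ \<sigma> i\<bar> < \<bar>x $ \<sigma> i - DRL \<sigma> P x $ \<sigma> i\<bar> \<and>
    (\<forall>j\<in>{1..<i}. x' $ \<sigma> j = DRL \<sigma> P x $ \<sigma> j)"
  then obtain x' where x': "x' \<in> Omega P"
    and less: "\<bar>x $ \<sigma> i - x' $ \<sigma> i\<bar> < \<bar>x $ \<sigma> i - DRL \<sigma> P x $ \<sigma> i\<bar>"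
    and eq: "\<And>j. j \<in> {1..<i} \<Longrightarrow> x' $ \<sigma> j = DRL \<sigma> P x $ \<sigma> j"
    by blast
  obtain m where m: "i = Suc m" using i by (cases i) auto
  \<comment> \<open>With \<open>i = Suc m\<close>, this is the constraint set repaired at step
    \<open>i\<close>; the coordinates before \<open>i\<close> that it reads are already final after
    step \<open>m\<close>.\<close>
  define Q where "Q = stage_subst \<sigma> P i (DRL_upto \<sigma> P x m)"
  have "DRL \<sigma> P x $ \<sigma> j = DRL_upto \<sigma> P x m $ \<sigma> j" if "j \<in> {1..<i}" for j
    unfolding DRL_def using that i m by (intro DRL_upto_stable[OF assms(4)]) auto
  then have "x' $ \<sigma> i \<in> Omega_var (\<sigma> i) Q"
    unfolding Q_def using eq by (intro stage_subst_solution[OF assms(4) i x']) simp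
  moreover have "fin_clauses Q"
    using fin_clauses_elim_last[of P \<sigma>] assms(1,2)
    by (auto simp: Q_def stage_subst_def stage_def fin_clauses_def)
  ultimately have "\<bar>x $ \<sigma> i - repair (\<sigma> i) Q (x $ \<sigma> i)\<bar> \<le> \<bar>x $ \<sigma> i - x' $ \<sigma> i\<bar>"
    by (intro repair_nearest)
  moreover have "DRL \<sigma> P x $ \<sigma> i = DRL_upto \<sigma> P x i $ \<sigma> i"
    unfolding DRL_def using i by (intro DRL_upto_stable[OF assms(4)]) auto
  ultimately show False using less by (simp add: m Q_def)
qed

end
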